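(* Let $k \geq 2$ be an integer, and let $f_k(n)$ denote the number of abelian squares of length $2n$ over an alphabet with $k$ letters. Then, as $n \to \infty$, $$ f_k(n) \sim k^{2n + k/2} \, (4\pi n)^{(1-k)/2}, $$ i.e., the ratio of the two sides tends to $1$ as $n \to \infty$ with $k$ fixed.
   Context: An abelian square of length $2n$ ($n>0$) is a string of the form $x x'$ where $|x| = |x'| = n$ and $x'$ is a permutation (rearrangement) of the symbols of $x$; equivalently, every letter of the alphabet occurs the same number of times in $x$ as in $x'$. (The rearrangement may be the identity, so ordinary squares $xx$ are included.) The quantity $f_k(n)$ is the number of such strings over the alphabet $\{1, 2, \ldots, k\}$. *)

theory Defs
  imports Complex_Main "HOL-Library.Multiset" "HOL-Library.Landau_Symbols"
begin

definition abelian_square :: "'a list \<Rightarrow> bool" where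
  "abelian_square w \<longleftrightarrow>
     (\<exists>x x'. w = x @ x' \<and> x \<noteq> [] \<and> length x = length x' \<and> mset x' = mset x)"

definition num_abelian_squares :: "nat \<Rightarrow> nat \<Rightarrow> nat" where
  "num_abelian_squares k n =
     card {w :: nat list. set w \<subseteq> {1..k} \<and> length w = 2 * n \<and> abelian_square w}"

end

theory Submission
  imports Defs "HOL-Probability.Probability" "HOL-Real_Asymp.Real_Asymp"
begin

text \<open>
  Grouping abelian squares by letter content expresses \<open>f\<^sub>k(n)\<close> as the sum of the squared
  multinomial coefficients. Splitting off the multiplicity of the last letter gives
  \<open>f\<^sub>k\<^sub>+\<^sub>1(n) = (\<Sum>j\<le>n. (n choose j)\<^sup>2 f\<^sub>k(j))\<close>. For \<open>g\<^sub>k(n) = f\<^sub>k(n) / k\<^sup>2\<^sup>n\<close>, this reads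
  \<open>g\<^sub>k\<^sub>+\<^sub>1(n) = (\<Sum>j\<le>n. b(j)\<^sup>2 g\<^sub>k(j))\<close> where \<open>b\<close> is the probability mass function of the binomial
  distribution with parameters \<open>n\<close> and \<open>p = k / (k + 1)\<close>.
  By Parseval's identity, \<open>(\<Sum>j\<le>n. b(j)\<^sup>2)\<close> is the integral of
  \<open>(1 - 2 p (1 - p) (1 - cos t))\<^sup>n / (2 \<pi>)\<close> over a period, so that Laplace's method yields
  \<open>1 / (2 sqrt (\<pi> p (1 - p) n))\<close> asymptotically. By Hoeffding's inequality, only the \<open>j\<close> with
  \<open>j / n\<close> close to \<open>p\<close> contribute, so \<open>g\<^sub>k(j)\<close> can be replaced by its asymptotics at \<open>p n\<close>, and
  the claim follows by induction on \<open>k\<close>, starting from \<open>g\<^sub>1(n) = 1\<close>.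
\<close>


subsection \<open>Squared multinomial coefficients\<close>

definition msets_of_size :: "'a set \<Rightarrow> nat \<Rightarrow> 'a multiset set" where
  "msets_of_size A n = {M. set_mset M \<subseteq> A \<and> size M = n}"

text \<open>The number of arrangements of \<open>M\<close> is the multinomial coefficient of its
  multiplicities. Unlike \<open>num_abelian_squares\<close>, this sum has value 1 at
  \<open>n = 0\<close>, which the recurrence in the alphabet needs.\<close>

definition sum_squared_multinomials :: "'a set \<Rightarrow> nat \<Rightarrow> nat" where
  "sum_squared_multinomials A n = (\<Sum>M\<in>msets_of_size A n. card (permutations_of_multiset M) ^ 2)"

lemma finite_msets_of_size:
  assumes "finite A"
  shows   "finite (msets_of_size A n)"
proof (rule finite_subset)
  show "msets_of_size A n \<subseteq> mset ` {xs. set xs \<subseteq> A \<and> length xs = n}"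
  proof
    fix M assume M: "M \<in> msets_of_size A n"
    obtain xs where "mset xs = M"
      using ex_mset by blast
    with M show "M \<in> mset ` {xs. set xs \<subseteq> A \<and> length xs = n}"
      by (auto simp: msets_of_size_def)
  qed
qed (use assms finite_lists_length_eq in auto)

text \<open>Both halves of an abelian square are arrangements of one multiset \<open>M\<close>,
  chosen independently of each other. Concatenation is injective on such pairs because all halves
  have length \<open>n\<close>, and distinct \<open>M\<close> give disjoint sets of pairs.\<close>

lemma num_abelian_squares_eq:
  assumes "n > 0"
  shows   "num_abelian_squares k n = sum_squared_multinomials {1..k} n"
proof -
  let ?P = "\<lambda>M::nat multiset. permutations_of_multiset M \<times> permutations_of_multiset M"
  let ?U = "\<Union>M\<in>msets_of_size {1..k} n. ?P M"
  have len: "length x = n" "length y = n" if "(x, y) \<in> ?U" for x y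
    using that by (auto simp: msets_of_size_def permutations_of_multiset_def simp flip: size_mset)
  have "{w. set w \<subseteq> {1..k} \<and> length w = 2 * n \<and> abelian_square w} = (\<lambda>(x, y). x @ y) ` ?U"
  proof (intro equalityI subsetI)
    fix w assume "w \<in> {w. set w \<subseteq> {1..k} \<and> length w = 2 * n \<and> abelian_square w}"
    then obtain x y where w: "w = x @ y" "length x = length y" "mset y = mset x"
      "set x \<subseteq> {1..k}" "length x = n"
      by (auto simp: abelian_square_def)
    hence "(x, y) \<in> ?U"
      by (auto simp: msets_of_size_def permutations_of_multiset_def intro!: bexI[of _ "mset x"])
    with w show "w \<in> (\<lambda>(x, y). x @ y) ` ?U"
      by force
  next
    fix w assume "w \<in> (\<lambda>(x, y). x @ y) ` ?U"
    then obtain x y where w: "w = x @ y" "(x, y) \<in> ?U"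
      by auto
    have xy: "mset x = mset y" "set_mset (mset x) \<subseteq> {1..k}"
      using w(2) by (auto simp: msets_of_size_def permutations_of_multiset_def)
    hence "set y = set x"
      by (metis set_mset_mset)
    moreover have "abelian_square (x @ y)"
      unfolding abelian_square_def using xy(1) len[OF w(2)] assms
      by (intro exI[of _ x] exI[of _ y]) auto
    ultimately show "w \<in> {w. set w \<subseteq> {1..k} \<and> length w = 2 * n \<and> abelian_square w}"
      using w(1) xy len[OF w(2)] by auto
  qed
  moreover have "inj_on (\<lambda>(x, y). x @ y) ?U"
  proof (intro inj_onI, clarify)
    fix x y x' y' M M'
    assume "x @ y = x' @ y'" "M \<in> msets_of_size {1..k} n" "M' \<in> msets_of_size {1..k} n"
      "x \<in> permutations_of_multiset M" "y \<in> permutations_of_multiset M"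
      "x' \<in> permutations_of_multiset M'" "y' \<in> permutations_of_multiset M'"
    moreover from this have "(x, y) \<in> ?U" and "(x', y') \<in> ?U"
      by blast+
    hence "length x = length x'"
      by (simp only: len(1))
    ultimately show "x = x' \<and> y = y'"
      by simp
  qed
  ultimately have "num_abelian_squares k n = card ?U"
    unfolding num_abelian_squares_def by (simp add: card_image)
  also have "\<dots> = (\<Sum>M\<in>msets_of_size {1..k} n. card (?P M))"
    by (subst card_UN_disjoint)
       (auto simp: finite_msets_of_size dest: permutations_of_multisetD)
  also have "\<dots> = sum_squared_multinomials {1..k} n"
    by (simp add: sum_squared_multinomials_def card_cartesian_product power2_eq_square)
  finally show ?thesis .
qed

section \<open>Recurrence in the number of letters\<close>

text \<open>The binomial coefficient chooses the positions of the new letter. The proof compares the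
  factorial formulas for both multisets and cancels the common product of factorials.\<close>

lemma card_permutations_of_multiset_add_replicate:
  assumes "a \<notin># M"
  shows   "card (permutations_of_multiset (M + replicate_mset m a)) =
             ((size M + m) choose m) * card (permutations_of_multiset M)"
proof (cases "m = 0")
  case False
  let ?N = "M + replicate_mset m a" and ?f = "\<lambda>M. \<Prod>x\<in>set_mset M. fact (count M x) :: nat"
  have "?f ?N = fact m * ?f M"
  proof -
    have "set_mset ?N = insert a (set_mset M)"
      using False by auto
    moreover have "(\<Prod>x\<in>set_mset M. fact (count ?N x)) = ?f M"
      using assms by (intro prod.cong) auto
    moreover have "count ?N a = m"
      using assms by (simp add: not_in_iff)
    ultimately show ?thesis
      using assms by simp
  qed
  hence "card (permutations_of_multiset ?N) * (fact m * ?f M) = fact (size M + m)"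
    using card_permutations_of_multiset_aux[of ?N] by simp
  also have "\<dots> = fact m * fact (size M) * ((size M + m) choose m)"
    using binomial_fact_lemma[of m "size M + m"] by simp
  also have "fact (size M) = card (permutations_of_multiset M) * ?f M"
    using card_permutations_of_multiset_aux[of M] by simp
  finally have "(fact m * ?f M) * card (permutations_of_multiset ?N) = 
      (fact m * ?f M) * (((size M + m) choose m) * card (permutations_of_multiset M))"
    by (simp only: mult_ac)
  moreover have "fact m * ?f M \<noteq> 0"
    by simp
  ultimately show ?thesis
    by (metis mult_left_cancel)
qed simp

text \<open>A multiset over the larger alphabet splits uniquely into a part of size \<open>j\<close>
  over \<open>A\<close> and \<open>n - j\<close> copies of \<open>a\<close>; its arrangement count
  is that of the part over \<open>A\<close> times \<open>n choose j\<close>.\<close>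

lemma sum_squared_multinomials_insert:
  assumes "finite A" "a \<notin> A"
  shows   "sum_squared_multinomials (insert a A) n =
             (\<Sum>j\<le>n. (n choose j) ^ 2 * sum_squared_multinomials A j)"
proof -
  let ?c = "\<lambda>M. card (permutations_of_multiset M) ^ 2"
  let ?f = "\<lambda>(j, M). M + replicate_mset (n - j) a"
  have "sum_squared_multinomials (insert a A) n =
          (\<Sum>z\<in>(SIGMA j:{..n}. msets_of_size A j). ?c (?f z))"
    unfolding sum_squared_multinomials_def
  proof (rule sum.reindex_bij_witness[symmetric])
    let ?g = "\<lambda>M. (n - count M a, filter_mset (\<lambda>x. x \<noteq> a) M)"
    fix M assume "M \<in> msets_of_size (insert a A) n"
    hence M: "set_mset M \<subseteq> insert a A" "size M = n"
      by (auto simp: msets_of_size_def)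
    have "size (filter_mset (\<lambda>x. x \<noteq> a) M) + count M a = n"
      using M(2) multiset_partition[of M "\<lambda>x. x \<noteq> a"]
      by (metis (mono_tags, lifting) count_replicate_mset filter_eq_replicate_mset
          not_not size_replicate_mset size_union filter_mset_cong)
    moreover have "count M a \<le> n"
      using M(2) count_le_size by metis
    ultimately show "?g M \<in> (SIGMA j:{..n}. msets_of_size A j)"
      using M(1) by (auto simp: msets_of_size_def)
    show "?f (?g M) = M"
      using \<open>count M a \<le> n\<close> by (auto intro!: multiset_eqI)
  next
    fix z assume z: "z \<in> (SIGMA j:{..n}. msets_of_size A j)"
    then obtain j M where [simp]: "z = (j, M)" and jM: "j \<le> n" "set_mset M \<subseteq> A" "size M = j"
      by (auto simp: msets_of_size_def)
    have a: "a \<notin># M"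
      using jM assms by auto
    show "?f z \<in> msets_of_size (insert a A) n"
      using jM by (auto simp: msets_of_size_def)
    show "(n - count (?f z) a, filter_mset (\<lambda>x. x \<noteq> a) (?f z)) = z"
      using jM a by (auto intro!: multiset_eqI simp: not_in_iff)
  qed auto
  also have "\<dots> = (\<Sum>j\<le>n. \<Sum>M\<in>msets_of_size A j. ?c (M + replicate_mset (n - j) a))"
    using assms by (subst sum.Sigma) (auto simp: finite_msets_of_size case_prod_unfold)
  also have "\<dots> = (\<Sum>j\<le>n. (n choose j) ^ 2 * sum_squared_multinomials A j)"
  proof (intro sum.cong refl)
    fix j assume j: "j \<in> {..n}"
    have "?c (M + replicate_mset (n - j) a) = (n choose j) ^ 2 * ?c M"
      if "M \<in> msets_of_size A j" for M
    proof -
      have "a \<notin># M" "size M = j"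
        using that assms by (auto simp: msets_of_size_def)
      thus ?thesis
        using j binomial_symmetric[of j n]
        by (simp add: card_permutations_of_multiset_add_replicate power_mult_distrib)
    qed
    thus "(\<Sum>M\<in>msets_of_size A j. ?c (M + replicate_mset (n - j) a)) =
            (n choose j) ^ 2 * sum_squared_multinomials A j"
      by (simp add: sum_squared_multinomials_def sum_distrib_left)
  qed
  finally show ?thesis .
qed

lemma sum_squared_multinomials_singleton: "sum_squared_multinomials {a} n = 1"
proof -
  have "msets_of_size {a} n = {replicate_mset n a}"
    by (auto simp: msets_of_size_def set_mset_subset_singletonD split: if_splits)
  moreover have "card (permutations_of_multiset (replicate_mset n a)) = 1"
    using card_permutations_of_multiset_add_replicate[of a "{#}" n] by simp
  ultimately show ?thesis
    by (simp add: sum_squared_multinomials_def)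
qed


subsection \<open>Sums of squared binomial probabilities\<close>

lemma has_integral_cos_int:
  fixes m :: int
  shows "((\<lambda>t. cos (of_int m * t)) has_integral (if m = 0 then 2 * pi else 0)) {-pi..pi}"
proof (cases "m = 0")
  case False
  have "((\<lambda>t. cos (of_int m * t)) has_integral
          (sin (of_int m * pi) / of_int m - sin (of_int m * (-pi)) / of_int m)) {-pi..pi}"
    by (rule fundamental_theorem_of_calculus)
       (use False in \<open>auto intro!: derivative_eq_intros simp flip: has_real_derivative_iff_has_vector_derivative\<close>)
  moreover have "sin (of_int m * pi) = 0"
    using sin_zero_iff_int2 by blast
  ultimately show ?thesis
    using False by simp
next
  case True
  show ?thesis
    using has_integral_const_real[of "1::real" "-pi" pi] True by simp
qed

text \<open>The squared modulus expands into a double sum of cosines of frequency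
  \<open>j - l\<close>; over a full period only the diagonal terms survive.\<close>

lemma parseval_trig_poly:
  fixes b :: "nat \<Rightarrow> real"
  assumes "finite A"
  shows "((\<lambda>t. (norm (\<Sum>j\<in>A. of_real (b j) * cis t ^ j)) ^ 2) has_integral
            (2 * pi * (\<Sum>j\<in>A. b j ^ 2))) {-pi..pi}"
proof -
  have *: "(norm (\<Sum>j\<in>A. of_real (b j) * cis t ^ j)) ^ 2 =
          (\<Sum>j\<in>A. \<Sum>l\<in>A. b j * b l * cos (of_int (int j - int l) * t))" for t
  proof -
    have "(norm (\<Sum>j\<in>A. of_real (b j) * cis t ^ j)) ^ 2 =
            (\<Sum>j\<in>A. b j * cos (j * t)) ^ 2 + (\<Sum>j\<in>A. b j * sin (j * t)) ^ 2"
      by (simp add: cmod_power2 Complex.DeMoivre)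
    also have "\<dots> = (\<Sum>j\<in>A. \<Sum>l\<in>A. b j * b l * cos (of_int (int j - int l) * t))"
      by (simp add: power2_eq_square sum_product left_diff_distrib cos_diff sum.distrib algebra_simps)
    finally show ?thesis .
  qed
  have "((\<lambda>t. \<Sum>j\<in>A. \<Sum>l\<in>A. b j * b l * cos (of_int (int j - int l) * t)) has_integral
          (\<Sum>j\<in>A. \<Sum>l\<in>A. b j * b l * (if int j - int l = 0 then 2 * pi else 0))) {-pi..pi}"
    by (intro has_integral_sum assms has_integral_mult_right has_integral_cos_int)
  also have "(\<Sum>j\<in>A. \<Sum>l\<in>A. b j * b l * (if int j - int l = 0 then 2 * pi else 0)) =
               (\<Sum>j\<in>A. \<Sum>l\<in>A. if l = j then 2 * pi * (b j * b l) else 0)"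
    by (intro sum.cong) auto
  also have "\<dots> = 2 * pi * (\<Sum>j\<in>A. b j ^ 2)"
    using assms by (simp add: power2_eq_square sum_distrib_left)
  finally show ?thesis
    by (simp only: *)
qed

text \<open>The characteristic function of the binomial distribution is the \<open>n\<close>-th
  power of \<open>p * cis t + (1 - p)\<close>. Its squared modulus is the integrand, so Parseval's
  identity applies.\<close>

lemma has_integral_sum_pmf_binomial_squared:
  assumes p: "p \<in> {0..1}"
  shows "((\<lambda>t. (1 - 2 * p * (1 - p) * (1 - cos t)) ^ n) has_integral
            (2 * pi * (\<Sum>j\<le>n. pmf (binomial_pmf n p) j ^ 2))) {-pi..pi}"
proof -
  have "(norm (\<Sum>j\<le>n. of_real (pmf (binomial_pmf n p) j) * cis t ^ j)) ^ 2 =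
          (1 - 2 * p * (1 - p) * (1 - cos t)) ^ n" for t
  proof -
    have "(\<Sum>j\<le>n. of_real (pmf (binomial_pmf n p) j) * cis t ^ j) =
            (of_real p * cis t + of_real (1 - p)) ^ n"
      unfolding binomial_ring using p
      by (intro sum.cong) (auto simp: power_mult_distrib mult_ac)
    moreover have "(norm (of_real p * cis t + of_real (1 - p))) ^ 2 =
            1 - 2 * p * (1 - p) * (1 - cos t)"
    proof -
      have "(norm (of_real p * cis t + of_real (1 - p))) ^ 2 = 
              (p * cos t + (1 - p)) ^ 2 + (p * sin t) ^ 2"
        by (simp add: cmod_power2)
      also have "\<dots> = p ^ 2 * (sin t ^ 2 + cos t ^ 2) + 2 * p * (1 - p) * cos t + (1 - p) ^ 2"
        by algebra
      also have "\<dots> = 1 - 2 * p * (1 - p) * (1 - cos t)"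
        unfolding sin_cos_squared_add by algebra
      finally show ?thesis .
    qed
    ultimately show ?thesis
      by (metis norm_power power_commutes power_mult mult.commute)
  qed
  thus ?thesis
    using parseval_trig_poly[of "{..n}" "pmf (binomial_pmf n p)"] by simp
qed

section \<open>Laplace's method for the Parseval integral\<close>

text \<open>By the half-angle formula it suffices that \<open>sin y \<ge> y / 2\<close> for
  \<open>y = \<bar>t\<bar> / 2\<close>. This quadratic bound on the whole period supplies the
  Gaussian majorant for dominated convergence.\<close>

lemma one_minus_cos_ge:
  fixes t :: real
  assumes "\<bar>t\<bar> \<le> pi"
  shows   "1 - cos t \<ge> t ^ 2 / 8"
proof -
  define y where "y = \<bar>t\<bar> / 2"
  have y: "0 \<le> y" "y ^ 2 \<le> 3"
  proof -
    \<comment> \<open>A rational upper bound for \<open>pi / 2\<close> whose square, 2.89, is still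
      below 3.\<close>
    have "y \<le> 1.7"
      using assms pi_approx by (simp add: y_def)
    moreover show "0 \<le> y"
      by (simp add: y_def)
    ultimately have "y ^ 2 \<le> 1.7 ^ 2"
      by (rule power_mono)
    thus "y ^ 2 \<le> 3"
      by (simp add: power2_eq_square)
  qed
  have "\<bar>sin y - y\<bar> \<le> \<bar>y\<bar> ^ 3 / 6"
    using Maclaurin_sin_bound[of y 3] by (simp add: eval_nat_numeral sin_coeff_def)
  also have "\<bar>y\<bar> ^ 3 / 6 \<le> y / 2"
    using y mult_left_mono[of "y ^ 2" 3 y] by (simp add: power2_eq_square power3_eq_cube)
  finally have "y / 2 \<le> sin y"
    by linarith
  hence "(y / 2) ^ 2 \<le> sin y ^ 2"
    using y by (intro power_mono) auto
  moreover have "cos t = 1 - 2 * sin y ^ 2"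
    using cos_double_sin[of y] by (simp add: y_def)
  ultimately show ?thesis
    by (simp add: y_def power2_eq_square)
qed

text \<open>The integrand is a multiple of the normal density with variance
  \<open>1 / (2 * c)\<close>.\<close>

lemma gaussian_integral:
  fixes c :: real
  assumes "c > 0"
  shows   "integrable lborel (\<lambda>x. exp (-c * x ^ 2))" "(\<integral>x. exp (-c * x ^ 2) \<partial>lborel) = sqrt (pi / c)"
proof -
  define \<sigma> where "\<sigma> = sqrt (1 / (2 * c))"
  have \<sigma>: "\<sigma> ^ 2 = 1 / (2 * c)"
    using assms by (simp add: \<sigma>_def)
  have "exp (-c * x ^ 2) = sqrt (pi / c) * normal_density 0 \<sigma> x" for x
    using assms by (simp add: normal_density_def \<sigma> real_sqrt_divide)
  hence *: "(\<lambda>x. exp (-c * x ^ 2)) = (\<lambda>x. sqrt (pi / c) * normal_density 0 \<sigma> x)"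
    by blast
  have "\<sigma> > 0"
    using assms by (simp add: \<sigma>_def)
  thus "integrable lborel (\<lambda>x. exp (-c * x ^ 2))" "(\<integral>x. exp (-c * x ^ 2) \<partial>lborel) = sqrt (pi / c)"
    unfolding * by auto
qed

lemma tendsto_sum_pmf_binomial_squared:
  assumes p: "p \<in> {0<..<1}"
  shows "(\<lambda>n. sqrt (real n) * (\<Sum>j\<le>n. pmf (binomial_pmf n p) j ^ 2))
            \<longlonglongrightarrow> 1 / (2 * sqrt (pi * p * (1 - p)))"
proof -
  define c where "c = p * (1 - p)"
  \<comment> \<open>The second bound is \<open>(2 * p - 1)\<^sup>2 \<ge> 0\<close> rearranged; it
    makes \<open>h\<close> nonnegative, so that bounds on \<open>h\<close> carry over to its
    powers.\<close>
  have c: "c > 0" "4 * c \<le> 1"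
    using p sum_squares_bound[of p "1 - p"] zero_le_power2[of "2 * p - 1"]
    by (auto simp: c_def power2_eq_square algebra_simps)
  define h where "h = (\<lambda>t::real. 1 - 2 * c * (1 - cos t))"
  have h: "0 \<le> h t" "h t \<le> 1" for t
  proof -
    have "1 - cos t \<le> 2" "1 - cos t \<ge> 0"
      using cos_ge_minus_one[of t] cos_le_one[of t] by linarith+
    with c have "2 * c * (1 - cos t) \<le> 2 * c * 2" "2 * c * (1 - cos t) \<ge> 0"
      by (intro mult_left_mono mult_nonneg_nonneg; simp)+
    moreover have "2 * c * 2 \<le> 1"
      using c by simp
    ultimately show "0 \<le> h t" "h t \<le> 1"
      unfolding h_def by linarith+
  qed
  \<comment> \<open>The substitution \<open>t = x / sqrt n\<close> turns the integrand into \<open>s\<close>, which tends to a Gaussian.\<close>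
  define s where "s = (\<lambda>n x. indicator {-pi..pi} (x / sqrt (real (Suc n))) * h (x / sqrt (real (Suc n))) ^ Suc n)"
  have meas [measurable]: "h \<in> borel_measurable borel"
    unfolding h_def by (intro borel_measurable_continuous_onI continuous_intros)

  have eq: "(\<integral>x. s n x \<partial>lborel) =
          2 * pi * (sqrt (real (Suc n)) * (\<Sum>j\<le>Suc n. pmf (binomial_pmf (Suc n) p) j ^ 2))" for n
  proof -
    have int: "((\<lambda>t. h t ^ Suc n) has_integral
            (2 * pi * (\<Sum>j\<le>Suc n. pmf (binomial_pmf (Suc n) p) j ^ 2))) {-pi..pi}"
      using has_integral_sum_pmf_binomial_squared[of p "Suc n"] p by (simp add: h_def c_def mult_ac)
    have "set_integrable lborel {-pi..pi} (\<lambda>t. h t ^ Suc n)"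
      unfolding h_def by (intro borel_integrable_atLeastAtMost' continuous_intros)
    from set_borel_integral_eq_integral(2)[OF this]
    have "(LINT t:{-pi..pi}|lborel. h t ^ Suc n) =
            2 * pi * (\<Sum>j\<le>Suc n. pmf (binomial_pmf (Suc n) p) j ^ 2)"
      using integral_unique[OF int] by simp
    moreover have "(\<integral>x. s n x \<partial>lborel) = 
        sqrt (real (Suc n)) * (LINT t:{-pi..pi}|lborel. h t ^ Suc n)"
      unfolding set_lebesgue_integral_def s_def
      by (subst lborel_integral_real_affine[where c = "1 / sqrt (real (Suc n))" and t = 0])
         (simp_all add: mult_ac)
    ultimately show ?thesis
      by (simp only: mult_ac)
  qed

  have "(\<lambda>n. \<integral>x. s n x \<partial>lborel) \<longlonglongrightarrow> (\<integral>x. exp (-c * x ^ 2) \<partial>lborel)"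
  proof (rule integral_dominated_convergence)
    \<comment> \<open>The majorant's rate \<open>c / 4\<close> is the factor \<open>2 * c\<close> in
      \<open>h\<close> times the 1/8 in the bound on \<open>1 - cos t\<close>.\<close>
    show "integrable lborel (\<lambda>x. exp (-(c / 4) * x ^ 2))"
      using c by (intro gaussian_integral) auto
    show "AE x in lborel. (\<lambda>n. s n x) \<longlonglongrightarrow> exp (-c * x ^ 2)"
    proof (intro AE_I2)
      fix x :: real
      \<comment> \<open>For fixed \<open>x\<close> the rescaled interval eventually contains
        \<open>x\<close>, so the indicator drops out.\<close>
      have "eventually (\<lambda>n. sqrt (real (Suc n)) \<ge> \<bar>x\<bar> / pi) at_top"
        by real_asymp
      hence "eventually (\<lambda>n. h (x / sqrt (real (Suc n))) ^ Suc n = s n x) at_top"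
      proof eventually_elim
        case (elim n)
        hence "\<bar>x / sqrt (real (Suc n))\<bar> \<le> pi"
          by (simp add: field_simps)
        hence "x / sqrt (real (Suc n)) \<in> {-pi..pi}"
          unfolding atLeastAtMost_iff by linarith
        thus ?case
          by (simp only: s_def indicator_simps mult_1_left)
      qed
      moreover have "(\<lambda>n. h (x / sqrt (real (Suc n))) ^ Suc n) \<longlonglongrightarrow> exp (-c * x ^ 2)"
      proof (cases "x = 0")
        case False
        hence "(\<lambda>n. h (x / sqrt (real (Suc n))) ^ Suc n) \<longlonglongrightarrow> exp (-(c * (x * x)))"
          unfolding h_def using c by real_asymp
        thus ?thesis
          by (simp add: power2_eq_square)
      qed (simp add: h_def)
      ultimately show "(\<lambda>n. s n x) \<longlonglongrightarrow> exp (-c * x ^ 2)"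
        by (rule Lim_transform_eventually[rotated])
    qed
    show "AE x in lborel. norm (s n x) \<le> exp (-(c / 4) * x ^ 2)" for n
    proof (intro AE_I2)
      fix x :: real
      define t where "t = x / sqrt (real (Suc n))"
      have t: "t ^ 2 * real (Suc n) = x ^ 2"
        by (simp add: t_def power_divide)
      show "norm (s n x) \<le> exp (-(c / 4) * x ^ 2)"
      proof (cases "\<bar>t\<bar> \<le> pi")
        case True
        have "norm (s n x) \<le> h t ^ Suc n"
          using h[of t] by (simp add: s_def t_def indicator_def)
        also have "h t \<le> exp (-(c / 4) * t ^ 2)"
        proof -
          have "h t \<le> 1 + (-(c / 4) * t ^ 2)"
            using mult_left_mono[OF one_minus_cos_ge[OF True], of "2 * c"] c by (simp add: h_def)
          thus ?thesis
            using exp_ge_add_one_self[of "-(c / 4) * t ^ 2"] by linarith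
        qed
        hence "h t ^ Suc n \<le> exp (-(c / 4) * t ^ 2) ^ Suc n"
          using h by (intro power_mono)
        also have "\<dots> = exp (real (Suc n) * (-(c / 4) * t ^ 2))"
          by (rule exp_of_nat_mult[symmetric])
        also have "real (Suc n) * (-(c / 4) * t ^ 2) = -(c / 4) * x ^ 2"
          unfolding t[symmetric] by (simp only: mult_ac)
        finally show ?thesis .
      next
        case False
        thus ?thesis
          by (auto simp: s_def t_def indicator_def abs_le_iff)
      qed
    qed
  qed (auto simp: s_def)
  hence "(\<lambda>n. 1 / (2 * pi) * (\<integral>x. s n x \<partial>lborel)) \<longlonglongrightarrow> 1 / (2 * pi) * sqrt (pi / c)"
    unfolding gaussian_integral(2)[OF c(1)] by (intro tendsto_intros)
  also have "1 / (2 * pi) * sqrt (pi / c) = 1 / (2 * sqrt (pi * p * (1 - p)))"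
  proof -
    have "1 / (2 * pi) * sqrt (pi / c) = (sqrt pi / pi) / (2 * sqrt c)"
      by (simp add: real_sqrt_divide)
    also have "sqrt pi / pi = 1 / sqrt pi"
      using sqrt_divide_self_eq[of pi] by (simp add: inverse_eq_divide)
    also have "1 / sqrt pi / (2 * sqrt c) = 1 / (2 * sqrt (pi * c))"
      by (simp add: real_sqrt_mult)
    finally show ?thesis
      by (simp add: c_def mult.assoc)
  qed
  \<comment> \<open>The index \<open>Suc n\<close> kept the scaling factor
    \<open>sqrt (real (Suc n))\<close> nonzero; the shift is undone here.\<close>
  finally show ?thesis
    unfolding eq by - (rule LIMSEQ_imp_Suc, simp)
qed

subsection \<open>Adding a letter\<close>

lemma tendsto_0_le_eps:
  fixes f :: "'a \<Rightarrow> real"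
  assumes "\<And>\<epsilon>. \<epsilon> > 0 \<Longrightarrow> eventually (\<lambda>x. \<bar>f x\<bar> \<le> \<epsilon> * K) F" "K > 0"
  shows   "(f \<longlongrightarrow> 0) F"
proof (rule tendstoI)
  fix e :: real assume "e > 0"
  with assms have "eventually (\<lambda>x. \<bar>f x\<bar> \<le> e / (2 * K) * K) F"
    by (intro assms) auto
  thus "eventually (\<lambda>x. dist (f x) 0 < e) F"
    by eventually_elim (use \<open>e > 0\<close> \<open>K > 0\<close> in simp)
qed

text \<open>The weights concentrate at \<open>j\<close> near \<open>p * n\<close>, where
  \<open>n powr a * g j = (j powr a * g j) * (j / n) powr (-a)\<close> is close to
  \<open>C * p powr (-a)\<close>. The bound on \<open>g\<close> controls the remaining
  \<open>j\<close>, whose total probability is exponentially small.\<close>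

lemma weighted_sum_asymp:
  fixes g :: "nat \<Rightarrow> real"
  assumes p: "p \<in> {0<..<1}" and bound: "\<And>j. \<bar>g j\<bar> \<le> 1"
    and lim: "(\<lambda>j. real j powr a * g j) \<longlonglongrightarrow> C"
    and tends: "(\<lambda>n. sqrt (real n) * (\<Sum>j\<le>n. pmf (binomial_pmf n p) j ^ 2)) \<longlonglongrightarrow> L"
  shows "(\<lambda>n. sqrt (real n) * real n powr a * (\<Sum>j\<le>n. pmf (binomial_pmf n p) j ^ 2 * g j))
            \<longlonglongrightarrow> C * p powr (-a) * L"
proof -
  define b where "b = (\<lambda>n. pmf (binomial_pmf n p))"
  define D where "D = C * p powr (-a)"
  define T where "T = (\<lambda>n. sqrt (real n) * (\<Sum>j\<le>n. b n j ^ 2))"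
  have T: "T \<longlonglongrightarrow> L"
    using tends by (simp add: T_def b_def)
  have b: "0 \<le> b n j" "b n j \<le> 1" for n j
    by (auto simp: b_def pmf_le_1)
  \<comment> \<open>\<open>E\<close> is the error of replacing \<open>n powr a * g j\<close> by its
    limiting value \<open>D\<close>; the sequence in question equals
    \<open>E n + D * T n\<close>.\<close>
  define E where "E = (\<lambda>n. sqrt (real n) * (\<Sum>j\<le>n. b n j ^ 2 * (real n powr a * g j - D)))"
  have "T n \<ge> 0" for n
    by (auto simp: T_def intro!: mult_nonneg_nonneg sum_nonneg)
  hence L: "L \<ge> 0"
    using T by (intro LIMSEQ_le_const) auto

  have "E \<longlonglongrightarrow> 0"
  proof (rule tendsto_0_le_eps)
    fix \<epsilon> :: real
    assume \<epsilon>: "\<epsilon> > 0"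
    \<comment> \<open>Joint continuity at \<open>(C, p)\<close> yields separate neighbourhoods:
      \<open>P\<close> for \<open>j powr a * g j\<close>, \<open>Q\<close> for
      \<open>j / n\<close>.\<close>
    have "((\<lambda>z. fst z * snd z powr (-a)) \<longlongrightarrow> C * p powr (-a)) (nhds C \<times>\<^sub>F nhds p)"
      using p by (intro tendsto_intros filterlim_fst filterlim_snd) auto
    hence "eventually (\<lambda>z. dist (fst z * snd z powr (-a)) D < \<epsilon>) (nhds C \<times>\<^sub>F nhds p)"
      unfolding D_def using \<epsilon> by (rule tendstoD)
    then obtain P Q where PQ: "eventually P (nhds C)" "eventually Q (nhds p)"
        "\<And>x y. P x \<Longrightarrow> Q y \<Longrightarrow> dist (x * y powr (-a)) D < \<epsilon>"
      unfolding eventually_prod_filter by auto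
    obtain d where d: "d > 0" "\<And>y. dist y p < d \<Longrightarrow> Q y"
      using PQ(2) by (auto simp: eventually_nhds_metric)
    have "eventually (\<lambda>j. P (real j powr a * g j)) at_top"
      using PQ(1) lim by (simp add: filterlim_iff)
    then obtain N where N: "\<And>j. j \<ge> N \<Longrightarrow> P (real j powr a * g j)"
      by (auto simp: eventually_at_top_linorder)
    \<comment> \<open>The bound \<open>p / 2\<close> forces \<open>j \<ge> p n / 2\<close>, hence \<open>j \<rightarrow> \<infinity>\<close>, in the central range.\<close>
    define \<eta> where "\<eta> = min d (p / 2)"
    have \<eta>: "\<eta> > 0"
      using d p by (auto simp: \<eta>_def)

    have "eventually (\<lambda>n. real n * p / 2 > real N) at_top"
      using p by real_asymp
    moreover have "eventually (\<lambda>n. n > (0::nat)) at_top"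
      by (rule eventually_gt_at_top)
    \<comment> \<open>The first term bounds the central range, the second the tail.\<close>
    ultimately have "eventually (\<lambda>n. \<bar>E n\<bar> \<le> \<epsilon> * T n +
          sqrt (real n) * ((real n powr a + \<bar>D\<bar>) * (2 * exp (-2 * real n * \<eta>\<^sup>2)))) at_top"
    proof eventually_elim
      case (elim n)
      define B where "B = {j::nat. \<bar>real j / real n - p\<bar> \<ge> \<eta>}"
      have "\<bar>b n j ^ 2 * (real n powr a * g j - D)\<bar> \<le>
              \<epsilon> * b n j ^ 2 + (real n powr a + \<bar>D\<bar>) * (if j \<in> B then b n j else 0)" for j
      proof (cases "j \<in> B")
        case True
        have "\<bar>real n powr a * g j - D\<bar> \<le> real n powr a * \<bar>g j\<bar> + \<bar>D\<bar>"
          by (rule order.trans[OF abs_triangle_ineq4]) (simp add: abs_mult)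
        also have "\<dots> \<le> real n powr a + \<bar>D\<bar>"
          using mult_left_mono[OF bound, of "real n powr a" j] by simp
        \<comment> \<open>One factor \<open>b n j\<close> is bounded by 1; the other is kept, so
          that the tail sums to a binomial probability.\<close>
        finally have "b n j * b n j * \<bar>real n powr a * g j - D\<bar> \<le> b n j * 1 * (real n powr a + \<bar>D\<bar>)"
          using b by (intro mult_mono) auto
        moreover have "0 \<le> \<epsilon> * b n j ^ 2"
          using \<epsilon> by simp
        ultimately show ?thesis
          using True by (simp add: abs_mult power2_eq_square mult_ac)
      next
        case False
        hence close: "\<bar>real j / real n - p\<bar> < d" "\<bar>real j / real n - p\<bar> < p / 2"
          by (simp_all only: B_def \<eta>_def mem_Collect_eq not_le min_less_iff_conj)
        have "real j / real n > p / 2"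
          using close(2) unfolding abs_less_iff by linarith
        hence "real j > real n * p / 2"
          using elim by (simp add: field_simps)
        hence j: "j > N"
          using elim by linarith
        have "dist (real j powr a * g j * (real j / real n) powr (-a)) D < \<epsilon>"
          using close j by (intro PQ N d) (auto simp: dist_real_def)
        moreover have "real j powr a * g j * (real j / real n) powr (-a) = real n powr a * g j"
          using j elim by (simp add: powr_divide powr_minus field_simps)
        ultimately have "\<bar>real n powr a * g j - D\<bar> \<le> \<epsilon>"
          by (simp add: dist_real_def)
        hence "b n j ^ 2 * \<bar>real n powr a * g j - D\<bar> \<le> b n j ^ 2 * \<epsilon>"
          by (intro mult_left_mono) auto
        thus ?thesis
          using False by (simp add: abs_mult mult_ac)
      qed
      hence "(\<Sum>j\<le>n. \<bar>b n j ^ 2 * (real n powr a * g j - D)\<bar>) \<le>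
              (\<Sum>j\<le>n. \<epsilon> * b n j ^ 2 + (real n powr a + \<bar>D\<bar>) * (if j \<in> B then b n j else 0))"
        by (intro sum_mono)
      also have "\<dots> = \<epsilon> * (\<Sum>j\<le>n. b n j ^ 2) +
              (real n powr a + \<bar>D\<bar>) * (\<Sum>j\<le>n. if j \<in> B then b n j else 0)"
        by (simp add: sum.distrib sum_distrib_left)
      also have "(\<Sum>j\<le>n. if j \<in> B then b n j else 0) = measure_pmf.prob (binomial_pmf n p) ({..n} \<inter> B)"
        unfolding b_def by (simp add: measure_measure_pmf_finite sum.inter_restrict)
      also have "\<dots> \<le> measure_pmf.prob (binomial_pmf n p) B"
        by (intro measure_pmf.finite_measure_mono) auto
      \<comment> \<open>Hoeffding's inequality.\<close>
      also have "\<dots> \<le> 2 * exp (-2 * real n * \<eta>\<^sup>2)"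
        unfolding B_def using p elim \<eta>
        using binomial_distribution.prob_abs_ge'[of p n \<eta>] by (simp add: binomial_distribution_def)
      finally have "(\<Sum>j\<le>n. \<bar>b n j ^ 2 * (real n powr a * g j - D)\<bar>) \<le> \<epsilon> * (\<Sum>j\<le>n. b n j ^ 2) +
              (real n powr a + \<bar>D\<bar>) * (2 * exp (-2 * real n * \<eta>\<^sup>2))"
        by (simp add: mult_left_mono)
      hence "\<bar>\<Sum>j\<le>n. b n j ^ 2 * (real n powr a * g j - D)\<bar> \<le> \<epsilon> * (\<Sum>j\<le>n. b n j ^ 2) +
              (real n powr a + \<bar>D\<bar>) * (2 * exp (-2 * real n * \<eta>\<^sup>2))"
        by (rule order.trans[OF sum_abs])
      hence "sqrt (real n) * \<bar>\<Sum>j\<le>n. b n j ^ 2 * (real n powr a * g j - D)\<bar> \<le>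
              sqrt (real n) * (\<epsilon> * (\<Sum>j\<le>n. b n j ^ 2) +
              (real n powr a + \<bar>D\<bar>) * (2 * exp (-2 * real n * \<eta>\<^sup>2)))"
        by (intro mult_left_mono) auto
      thus ?case
        by (simp add: E_def T_def abs_mult algebra_simps)
    qed
    moreover have "(\<lambda>n. \<epsilon> * T n +
          sqrt (real n) * ((real n powr a + \<bar>D\<bar>) * (2 * exp (-2 * real n * \<eta>\<^sup>2)))) \<longlonglongrightarrow> \<epsilon> * L + 0"
    proof (intro tendsto_add tendsto_mult T tendsto_const)
      define \<kappa> D' where "\<kappa> = \<eta>\<^sup>2" and "D' = \<bar>D\<bar>"
      have "\<kappa> > 0"
        using \<eta> by (simp add: \<kappa>_def)
      thus "(\<lambda>n. sqrt (real n) * ((real n powr a + \<bar>D\<bar>) * (2 * exp (-2 * real n * \<eta>\<^sup>2)))) \<longlonglongrightarrow> 0"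
        unfolding \<kappa>_def[symmetric] D'_def[symmetric] by real_asymp
    qed
    \<comment> \<open>The constant \<open>L + 1\<close> leaves room above the limit
      \<open>\<epsilon> * L\<close>, and is positive even if \<open>L = 0\<close>.\<close>
    hence "eventually (\<lambda>n. \<epsilon> * T n + sqrt (real n) * ((real n powr a + \<bar>D\<bar>) *
              (2 * exp (-2 * real n * \<eta>\<^sup>2))) < \<epsilon> * (L + 1)) at_top"
      using \<epsilon> by (intro order_tendstoD) (auto simp: algebra_simps)
    ultimately show "eventually (\<lambda>n. \<bar>E n\<bar> \<le> \<epsilon> * (L + 1)) at_top"
      by eventually_elim linarith
  qed (use L in auto)
  hence "(\<lambda>n. E n + D * T n) \<longlonglongrightarrow> 0 + D * L"
    by (intro tendsto_intros T)
  also have "(\<lambda>n. E n + D * T n) =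
      (\<lambda>n. sqrt (real n) * real n powr a * (\<Sum>j\<le>n. pmf (binomial_pmf n p) j ^ 2 * g j))"
    by (simp add: E_def T_def b_def fun_eq_iff algebra_simps sum_subtractf sum_distrib_left)
  finally show ?thesis
    by (simp add: D_def)
qed

section \<open>Induction on the number of letters\<close>

text \<open>Here \<open>g k n\<close> is the probability that two independent uniform words of
  length \<open>n\<close> have the same content. Both must contain equally many letters
  \<open>j\<close> other than the last one, and this number is binomial with parameter
  \<open>k / (k + 1)\<close>.\<close>

lemma sum_squared_multinomials_scaled_Suc:
  assumes "k \<ge> 1"
  defines "g \<equiv> \<lambda>k n. real (sum_squared_multinomials {1..k} n) / real k ^ (2 * n)"
  shows   "g (Suc k) n = (\<Sum>j\<le>n. pmf (binomial_pmf n (real k / real (Suc k))) j ^ 2 * g k j)"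
proof -
  have "{1..Suc k} = insert (Suc k) {1..k}"
    by auto
  hence "g (Suc k) n = (\<Sum>j\<le>n. real (n choose j) ^ 2 * real (sum_squared_multinomials {1..k} j))
                        / real (Suc k) ^ (2 * n)"
    by (simp add: g_def sum_squared_multinomials_insert)
  also have "\<dots> = (\<Sum>j\<le>n. pmf (binomial_pmf n (real k / real (Suc k))) j ^ 2 * g k j)"
    unfolding sum_divide_distrib
  proof (intro sum.cong refl)
    fix j assume j: "j \<in> {..n}"
    have "pmf (binomial_pmf n (real k / real (Suc k))) j =
            real (n choose j) * (real k / real (Suc k)) ^ j * (1 - real k / real (Suc k)) ^ (n - j)"
      by (intro pmf_binomial) auto
    also have "1 - real k / real (Suc k) = 1 / real (Suc k)"
      by (simp add: field_simps)
    also have "real (n choose j) * (real k / real (Suc k)) ^ j * (1 / real (Suc k)) ^ (n - j) =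
                 real (n choose j) * real k ^ j / (real (Suc k) ^ j * real (Suc k) ^ (n - j))"
      by (simp add: power_divide)
    also have "real (Suc k) ^ j * real (Suc k) ^ (n - j) = real (Suc k) ^ n"
      using j by (simp flip: power_add)
    finally have pmf: "pmf (binomial_pmf n (real k / real (Suc k))) j =
                         real (n choose j) * real k ^ j / real (Suc k) ^ n" .
    show "real (n choose j) ^ 2 * real (sum_squared_multinomials {1..k} j) / real (Suc k) ^ (2 * n) =
            pmf (binomial_pmf n (real k / real (Suc k))) j ^ 2 * g k j"
      unfolding pmf using assms
      by (simp add: g_def power_mult_distrib power_divide power_mult mult.commute[of 2] del: of_nat_Suc)
  qed
  finally show ?thesis .
qed

text \<open>Supplies the bound on \<open>g\<close> for the tail estimate. Inductively, squared
  probabilities are at most the probabilities, which sum to at most 1.\<close>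

lemma sum_squared_multinomials_le:
  assumes "k \<ge> 1"
  shows   "real (sum_squared_multinomials {1..k} n) / real k ^ (2 * n) \<le> 1"
  using assms
proof (induction k arbitrary: n rule: dec_induct)
  case base
  thus ?case
    by (simp add: sum_squared_multinomials_singleton)
next
  case (step k)
  let ?b = "\<lambda>j. pmf (binomial_pmf n (real k / real (Suc k))) j"
  have "real (sum_squared_multinomials {1..Suc k} n) / real (Suc k) ^ (2 * n) \<le> (\<Sum>j\<le>n. ?b j * 1)"
    unfolding sum_squared_multinomials_scaled_Suc[OF step.hyps(1)]
  proof (intro sum_mono mult_mono step.IH)
    show "?b j ^ 2 \<le> ?b j" for j
      unfolding power2_eq_square by (intro mult_left_le pmf_le_1 pmf_nonneg)
  qed auto
  also have "\<dots> = measure_pmf.prob (binomial_pmf n (real k / real (Suc k))) {..n}"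
    by (simp add: measure_measure_pmf_finite)
  also have "\<dots> \<le> 1"
    by simp
  finally show ?case .
qed

text \<open>Each new letter raises the exponent of \<open>n\<close> by 1/2 and multiplies the
  constant by \<open>p powr (-a) / (2 * sqrt (pi * p * (1 - p)))\<close>, where
  \<open>p = k / (k + 1)\<close> and \<open>a = (k - 1) / 2\<close>.\<close>

lemma tendsto_sum_squared_multinomials:
  assumes "k \<ge> 1"
  shows   "(\<lambda>n. real n powr ((real k - 1) / 2) *
              (real (sum_squared_multinomials {1..k} n) / real k ^ (2 * n)))
             \<longlonglongrightarrow> real k powr (real k / 2) * (4 * pi) powr ((1 - real k) / 2)"
  using assms
proof (induction k rule: dec_induct)
  case base
  \<comment> \<open>Only eventually, since \<open>0 powr 0 = 0\<close>.\<close>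
  have "eventually (\<lambda>n. real n powr 0 = 1) at_top"
    using eventually_gt_at_top[of 0] by eventually_elim auto
  thus ?case
    by (simp add: sum_squared_multinomials_singleton tendsto_eventually)
next
  case (step k)
  define p where "p = real k / real (Suc k)"
  define a where "a = (real k - 1) / 2"
  define C where "C = real k powr (real k / 2) * (4 * pi) powr (-a)"
  define g where "g = (\<lambda>k n. real (sum_squared_multinomials {1..k} n) / real k ^ (2 * n))"
  have p: "p \<in> {0<..<1}"
    using step.hyps by (auto simp: p_def)
  have IH: "(\<lambda>n. real n powr a * g k n) \<longlonglongrightarrow> C"
    using step.IH by (simp add: a_def C_def g_def minus_divide_left)
  have "\<bar>g k n\<bar> \<le> 1" for n
    using sum_squared_multinomials_le[OF step.hyps(1), of n] by (simp add: g_def)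
  from weighted_sum_asymp[OF p this IH tendsto_sum_pmf_binomial_squared[OF p]]
  have "(\<lambda>n. sqrt (real n) * real n powr a * g (Suc k) n)
           \<longlonglongrightarrow> C * p powr (-a) * (1 / (2 * sqrt (pi * p * (1 - p))))"
    by (simp only: g_def p_def sum_squared_multinomials_scaled_Suc[OF step.hyps(1)])
  also have "(\<lambda>n. sqrt (real n) * real n powr a * g (Suc k) n) =
             (\<lambda>n. real n powr ((real (Suc k) - 1) / 2) * g (Suc k) n)"
    by (simp add: a_def powr_half_sqrt[symmetric] field_simps flip: powr_add)
  also have "C * p powr (-a) * (1 / (2 * sqrt (pi * p * (1 - p)))) =
             real (Suc k) powr (real (Suc k) / 2) * (4 * pi) powr ((1 - real (Suc k)) / 2)"
  proof -
    \<comment> \<open>In terms of logarithms, all that remains is a linear identity between exponents.\<close>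
    define x y z where "x = ln (real k)" and "y = ln (real (Suc k))" and "z = ln (4 * pi)"
    have k: "real k > 0"
      using step.hyps by simp
    have ln: "real k = exp x" "real (Suc k) = exp y" "4 * pi = exp z"
      using k by (simp_all add: x_def y_def z_def)
    have "2 * sqrt (pi * p * (1 - p)) = sqrt (4 * pi * p * (1 - p))"
      by (simp add: real_sqrt_mult)
    also have "4 * pi * p * (1 - p) = exp (z + x - 2 * y)"
    proof -
      have "1 - p = 1 / real (Suc k)"
        by (simp add: p_def field_simps)
      thus ?thesis
        unfolding p_def ln by (simp add: exp_add exp_diff exp_double power2_eq_square)
    qed
    also have "sqrt \<dots> = exp ((z + x - 2 * y) / 2)"
      by (simp add: powr_def flip: powr_half_sqrt)
    finally have eq1: "2 * sqrt (pi * p * (1 - p)) = exp ((z + x - 2 * y) / 2)" .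
    have pows: "exp u powr v = exp (v * u)" for u v :: real
      by (simp add: powr_def)
    have eq2: "p powr (-a) = exp ((-a) * (x - y))"
      unfolding p_def ln by (simp only: pows flip: exp_diff)
    have "C * p powr (-a) * (1 / (2 * sqrt (pi * p * (1 - p)))) =
            exp (real k / 2 * x + (-a) * z + (-a) * (x - y) - (z + x - 2 * y) / 2)"
      unfolding C_def eq1 eq2
      by (subst ln(1)) (simp only: ln(3) pows exp_add exp_diff mult_1_right times_divide_eq_right)
    also have "real k / 2 * x + (-a) * z + (-a) * (x - y) - (z + x - 2 * y) / 2 =
               real (Suc k) / 2 * y + (1 - real (Suc k)) / 2 * z"
      by (simp add: a_def field_simps)
    also have "exp \<dots> = real (Suc k) powr (real (Suc k) / 2) * (4 * pi) powr ((1 - real (Suc k)) / 2)"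
      using k by (simp add: powr_def exp_add y_def z_def del: of_nat_Suc)
    finally show ?thesis .
  qed
  finally show ?case
    by (simp only: g_def)
qed

theorem theorem4:
  fixes k :: nat
  assumes "k \<ge> 2"
  shows "(\<lambda>n::nat. real (num_abelian_squares k n)) \<sim>[at_top]
         (\<lambda>n. real k powr (2 * real n + real k / 2) * (4 * pi * real n) powr ((1 - real k) / 2))"
proof -
  define c where "c = real k powr (real k / 2) * (4 * pi) powr ((1 - real k) / 2)"
  have c: "c > 0"
    using assms by (simp add: c_def)
  let ?f = "\<lambda>n. real n powr ((real k - 1) / 2) *
              (real (sum_squared_multinomials {1..k} n) / real k ^ (2 * n))"
  have "(\<lambda>n. ?f n / c) \<longlonglongrightarrow> c / c"
    using tendsto_sum_squared_multinomials[of k] assms c unfolding c_def[symmetric]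
    by (intro tendsto_intros) auto
  \<comment> \<open>The index 0 is excluded: the empty word is no abelian square, whereas the sum of
    squared multinomials is 1 there.\<close>
  moreover have "eventually (\<lambda>n. ?f n / c = real (num_abelian_squares k n) /
      (real k powr (2 * real n + real k / 2) * (4 * pi * real n) powr ((1 - real k) / 2))) at_top"
    using eventually_gt_at_top[of 0]
  proof eventually_elim
    case (elim n)
    have "real k powr (2 * real n) = real k ^ (2 * n)"
      using assms powr_realpow[of "real k" "2 * n"] by simp
    hence eq1: "real k powr (2 * real n + real k / 2) = real k ^ (2 * n) * real k powr (real k / 2)"
      by (simp only: powr_add)
    have eq2: "(4 * pi * real n) powr ((1 - real k) / 2) =
                 (4 * pi) powr ((1 - real k) / 2) * real n powr ((1 - real k) / 2)"
      by (simp add: powr_mult)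
    have "(real k - 1) / 2 = -((1 - real k) / 2)"
      by (simp add: field_simps)
    hence eq3: "real n powr ((real k - 1) / 2) = 1 / real n powr ((1 - real k) / 2)"
      by (simp only: powr_minus_divide)
    show ?case
      unfolding eq1 eq2 eq3 c_def using elim by (simp add: num_abelian_squares_eq)
  qed
  ultimately show ?thesis
    using c by (intro asymp_equivI') (auto elim: Lim_transform_eventually)
qed

end
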